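(* A continuous time $(\alpha,q)$-OU process does not exist for $q>1$: for no $q>1$ and $\alpha>0$ does there exist a stochastic process $\mathbf{Y}=(Y_t)_{t\in\mathbb{R}}$ such that for every $\delta>0$ the random sequence $(Y_{n\delta})_{n\in\mathbb{Z}}$ is a 1TSP with parameters $\rho=e^{-\alpha\delta}$ and $q$.
   Context: A 1TSP is a square integrable random sequence $\mathbf{X}=\{X_n\}_{n\in\mathbb{Z}}$ with all covariance matrices non-singular and constant first two moments, normalized so that $\mathbb{E}X_n=0$, $\mathbb{E}X_n^2=1$, such that $\rho:=\operatorname{corr}(X_0,X_1)\neq0$ and such that, with $\mathcal{F}_{\neq n}=\sigma(X_k:k\neq n)$, there exist real constants $a,A,B,C,D$ with, for all $n\in\mathbb{Z}$, almost surely, $$\mathbb{E}(X_n|\mathcal{F}_{\neq n})=a(X_{n-1}+X_{n+1}),$$ $$\mathbb{E}(X_n^2|\mathcal{F}_{\neq n})=A(X_{n-1}^2+X_{n+1}^2)+BX_{n-1}X_{n+1}+D(X_{n-1}+X_{n+1})+C.$$ Necessarily $0<|\rho|<1$. The second parameter of the 1TSP is $$q=\frac{\rho^4+B(\rho+1/\rho)^2-1}{1+\rho^4\left(B(\rho+1/\rho)^2-1\right)}.$$ It is known from earlier work that 1TSPs do not exist for $q\notin[-1,1]\cup\{\rho^{-2/n}:n\in\mathbb{N}\}$. *)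

theory Defs
  imports "HOL-Probability.Probability" "Jordan_Normal_Form.Determinant"
begin

definition covariance :: "'a measure \<Rightarrow> ('a \<Rightarrow> real) \<Rightarrow> ('a \<Rightarrow> real) \<Rightarrow> real" where
  "covariance M U V =
    (LINT \<omega>|M. (U \<omega> - (LINT \<omega>'|M. U \<omega>')) * (V \<omega> - (LINT \<omega>'|M. V \<omega>')))"

definition correlation :: "'a measure \<Rightarrow> ('a \<Rightarrow> real) \<Rightarrow> ('a \<Rightarrow> real) \<Rightarrow> real" where
  "correlation M U V = covariance M U V / (sqrt (covariance M U U) * sqrt (covariance M V V))"

definition covariance_matrix ::
    "'a measure \<Rightarrow> (int \<Rightarrow> 'a \<Rightarrow> real) \<Rightarrow> int list \<Rightarrow> real Matrix.mat" where
  "covariance_matrix M X ts =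
    Matrix.mat (length ts) (length ts) (\<lambda>(i, j). covariance M (X (ts ! i)) (X (ts ! j)))"

definition sigma_except :: "'a measure \<Rightarrow> (int \<Rightarrow> 'a \<Rightarrow> real) \<Rightarrow> int \<Rightarrow> 'a measure" where
  "sigma_except M X n =
    sigma (space M) (\<Union>k\<in>{k. k \<noteq> n}. {X k -` S \<inter> space M | S. S \<in> sets borel})"

definition one_tsp_with ::
    "'a measure \<Rightarrow> (int \<Rightarrow> 'a \<Rightarrow> real) \<Rightarrow> real \<Rightarrow> real \<Rightarrow> real \<Rightarrow> real \<Rightarrow> real \<Rightarrow> bool" where
  "one_tsp_with M X a A B C D \<longleftrightarrow>
    prob_space M \<and>
    (\<forall>n. X n \<in> borel_measurable M) \<and>
    (\<forall>n. integrable M (\<lambda>\<omega>. (X n \<omega>)\<^sup>2)) \<and>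
    (\<forall>ts. distinct ts \<longrightarrow> Determinant.det (covariance_matrix M X ts) \<noteq> 0) \<and>
    (\<forall>n. (LINT \<omega>|M. X n \<omega>) = 0) \<and>
    (\<forall>n. (LINT \<omega>|M. (X n \<omega>)\<^sup>2) = 1) \<and>
    correlation M (X 0) (X 1) \<noteq> 0 \<and>
    (\<forall>n. AE \<omega> in M.
       real_cond_exp M (sigma_except M X n) (X n) \<omega> = a * (X (n - 1) \<omega> + X (n + 1) \<omega>)) \<and>
    (\<forall>n. AE \<omega> in M.
       real_cond_exp M (sigma_except M X n) (\<lambda>\<omega>'. (X n \<omega>')\<^sup>2) \<omega> =
         A * ((X (n - 1) \<omega>)\<^sup>2 + (X (n + 1) \<omega>)\<^sup>2)
         + B * X (n - 1) \<omega> * X (n + 1) \<omega>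
         + D * (X (n - 1) \<omega> + X (n + 1) \<omega>) + C)"

(* If the denominator vanishes, the parameter is undefined in the mathematics and 0 here;
   this cannot affect claims about q > 1. *)
definition tsp_q :: "real \<Rightarrow> real \<Rightarrow> real" where
  "tsp_q \<rho> B =
    (\<rho> ^ 4 + B * (\<rho> + 1 / \<rho>)\<^sup>2 - 1) / (1 + \<rho> ^ 4 * (B * (\<rho> + 1 / \<rho>)\<^sup>2 - 1))"

(* Should the constants of the regressions not be unique, any admissible B may give q. *)
definition one_tsp :: "'a measure \<Rightarrow> (int \<Rightarrow> 'a \<Rightarrow> real) \<Rightarrow> real \<Rightarrow> real \<Rightarrow> bool" where
  "one_tsp M X \<rho> q \<longleftrightarrow>
    (\<exists>a A B C D. one_tsp_with M X a A B C D \<and>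
       \<rho> = correlation M (X 0) (X 1) \<and> q = tsp_q \<rho> B)"

definition ou_process :: "'a measure \<Rightarrow> (real \<Rightarrow> 'a \<Rightarrow> real) \<Rightarrow> real \<Rightarrow> real \<Rightarrow> bool" where
  "ou_process M Y \<alpha> q \<longleftrightarrow>
    prob_space M \<and>
    (\<forall>t. Y t \<in> borel_measurable M) \<and>
    (\<forall>\<delta>>0. one_tsp M (\<lambda>n. Y (of_int n * \<delta>)) (exp (- \<alpha> * \<delta>)) q)"

end

theory Submission
  imports Defs
begin

text \<open>
  A single small mesh already gives a contradiction: for a sequence $X$ with correlation $\rho$
  and $q > 1$ one has $\rho^2 q \le 1$, and $\rho = e^{-\alpha\delta}$ tends to 1 with
  $\delta$.  To see the inequality, first turn the two-sided regressions into one-sided ones: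
  integrating them over an event of the past gives linear recursions in time whose bounded
  solutions are explicit, so that $E(X_{n+k} | X_j, j \le n) = \rho^k X_n$ and
  $E(X_{n+k}^2 | X_j, j \le n) = \rho^{2k} X_n^2 + 1 - \rho^{2k}$.  These relations and their time
  reversals force a finite fourth moment.  Computing $E(X_0 X_1^2 X_2)$ once with the one-sided
  linear regression and once with the two-sided quadratic one then gives $E X_0^4 = 2 + q$.  Finally
  the second Al-Salam--Chihara polynomial
  $p = X_1^2 - \rho(1+q) X_0 X_1 + \rho^2 q X_0^2 - (1 - \rho^2)$ satisfies
  $0 \le E p^2 = (1-\rho^2)(1+q)(1-\rho^2 q)$.
\<close>

section \<open>Sigma-algebras generated by part of the sequence\<close>

text \<open>An arbitrary index set lets one family of facts serve both the two-sided conditioning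
  (all indices but one) and the past (all indices up to \<open>n\<close>).\<close>

definition gen_alg :: "'a measure \<Rightarrow> (int \<Rightarrow> 'a \<Rightarrow> real) \<Rightarrow> int set \<Rightarrow> 'a measure" where
  "gen_alg M X K =
    sigma (space M) (\<Union>k\<in>K. {X k -` S \<inter> space M | S. S \<in> sets borel})"

lemma sigma_except_eq_gen_alg: "sigma_except M X n = gen_alg M X {k. k \<noteq> n}"
  by (simp add: sigma_except_def gen_alg_def)

lemma space_gen_alg [simp]: "space (gen_alg M X K) = space M"
  by (simp add: gen_alg_def space_measure_of_conv)

lemma sets_gen_alg:
  "sets (gen_alg M X K) =
    sigma_sets (space M) (\<Union>k\<in>K. {X k -` S \<inter> space M | S. S \<in> sets borel})"
  unfolding gen_alg_def by (rule sets_measure_of) auto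

lemma gen_alg_mono: "K \<subseteq> L \<Longrightarrow> sets (gen_alg M X K) \<subseteq> sets (gen_alg M X L)"
  unfolding sets_gen_alg by (rule sigma_sets_mono') blast

lemma subalgebra_gen_alg:
  assumes "\<And>k. X k \<in> borel_measurable M"
  shows "subalgebra M (gen_alg M X K)"
proof -
  have "(\<Union>k\<in>K. {X k -` S \<inter> space M | S. S \<in> sets borel}) \<subseteq> sets M"
    using assms by (auto intro: measurable_sets)
  then show ?thesis
    unfolding subalgebra_def sets_gen_alg
    by (simp add: sets.sigma_sets_subset)
qed

lemma measurable_gen_alg:
  assumes "k \<in> K"
  shows "X k \<in> borel_measurable (gen_alg M X K)"
proof (rule measurableI)
  fix S :: "real set" assume "S \<in> sets borel"
  then show "X k -` S \<inter> space (gen_alg M X K) \<in> sets (gen_alg M X K)"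
    using assms unfolding sets_gen_alg by (auto intro!: sigma_sets.Basic)
qed simp

lemma gen_alg_uminus:
  "gen_alg M (\<lambda>n. X (- n)) K = gen_alg M X (uminus ` K)"
  unfolding gen_alg_def by simp

section \<open>Testing conditional expectations with integrable products\<close>

text \<open>This is the pull-out property followed by taking expectations. The test function
  \<open>g\<close> may be unbounded as long as \<open>g * Z\<close> is integrable, so monomials in
  the sequence can serve as tests; integrability on the other side comes for free.\<close>

lemma (in prob_space) real_cond_exp_test:
  fixes g Z W :: "'a \<Rightarrow> real"
  assumes "subalgebra M F" and "AE x in M. real_cond_exp M F Z x = W x"
    and "g \<in> borel_measurable F" "Z \<in> borel_measurable M" "W \<in> borel_measurable M"
    and "integrable M (\<lambda>x. g x * Z x)"
  shows "integrable M (\<lambda>x. g x * W x)"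
    and "(\<integral>x. g x * Z x \<partial>M) = (\<integral>x. g x * W x \<partial>M)"
proof -
  interpret F: finite_measure_subalgebra M F
    using assms(1) by unfold_locales
  note [measurable] = assms(4,5) measurable_from_subalg[OF assms(1,3)]
  have ae: "AE x in M. g x * real_cond_exp M F Z x = g x * W x"
    using assms(2) by auto
  show "integrable M (\<lambda>x. g x * W x)"
    using F.real_cond_exp_intg(1)[OF assms(6,3,4)] ae
    by (subst (asm) integrable_cong_AE[OF _ _ ae]) auto
  show "(\<integral>x. g x * Z x \<partial>M) = (\<integral>x. g x * W x \<partial>M)"
    using F.real_cond_exp_intg(2)[OF assms(6,3,4)] integral_cong_AE[OF _ _ ae]
    by simp
qed

lemma square_integrable_prod:
  fixes f g :: "'a \<Rightarrow> real"
  assumes "f \<in> borel_measurable M" "g \<in> borel_measurable M"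
    and "integrable M (\<lambda>x. (f x)\<^sup>2)" "integrable M (\<lambda>x. (g x)\<^sup>2)"
  shows "integrable M (\<lambda>x. f x * g x)"
proof (rule Bochner_Integration.integrable_bound)
  show "integrable M (\<lambda>x. (f x)\<^sup>2 + (g x)\<^sup>2)"
    using assms by auto
  show "AE x in M. norm (f x * g x) \<le> norm ((f x)\<^sup>2 + (g x)\<^sup>2)"
  proof (rule AE_I2)
    fix x
    have "2 * \<bar>f x * g x\<bar> \<le> (f x)\<^sup>2 + (g x)\<^sup>2"
      using sum_squares_bound[of "\<bar>f x\<bar>" "\<bar>g x\<bar>"] by (simp add: abs_mult)
    then show "norm (f x * g x) \<le> norm ((f x)\<^sup>2 + (g x)\<^sup>2)" by simp
  qed
qed (use assms in auto)

section \<open>Elementary facts on powers, truncations and recursions\<close>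

text \<open>The cases k = 1, 2, 3 form a Vandermonde system with the distinct nodes 1,
  \<open>r\<close>, \<open>r ^ 2\<close>. Differences of consecutive equations eliminate first
  \<open>c0\<close>, then \<open>c1\<close>.\<close>

lemma vandermonde_powers_eq_0:
  fixes r c0 c1 c2 :: real
  assumes "0 < r" "r < 1"
    and "\<And>k. 1 \<le> k \<Longrightarrow> c0 + c1 * r ^ k + c2 * r ^ (2 * k) = 0"
  shows "c0 = 0" "c1 = 0" "c2 = 0"
proof -
  have 1: "c0 + c1 * r + c2 * r ^ 2 = 0" and 2: "c0 + c1 * r ^ 2 + c2 * r ^ 4 = 0"
    and 3: "c0 + c1 * r ^ 3 + c2 * r ^ 6 = 0"
    using assms(3)[of 1] assms(3)[of 2] assms(3)[of 3] by simp_all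
  have "r * (1 - r) * (c1 + c2 * (r * (1 + r))) =
      (c0 + c1 * r + c2 * r ^ 2) - (c0 + c1 * r ^ 2 + c2 * r ^ 4)"
    by (simp add: algebra_simps eval_nat_numeral)
  then have "r * (1 - r) * (c1 + c2 * (r * (1 + r))) = 0" using 1 2 by simp
  then have 4: "c1 + c2 * (r * (1 + r)) = 0" using assms(1,2) by simp
  have "r ^ 2 * (1 - r) * (c1 + c2 * (r ^ 2 * (1 + r))) =
      (c0 + c1 * r ^ 2 + c2 * r ^ 4) - (c0 + c1 * r ^ 3 + c2 * r ^ 6)"
    by (simp add: algebra_simps eval_nat_numeral)
  then have "r ^ 2 * (1 - r) * (c1 + c2 * (r ^ 2 * (1 + r))) = 0" using 2 3 by simp
  then have 5: "c1 + c2 * (r ^ 2 * (1 + r)) = 0" using assms(1,2) by simp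
  have "c2 * (r * (1 + r) * (1 - r)) =
      (c1 + c2 * (r * (1 + r))) - (c1 + c2 * (r ^ 2 * (1 + r)))"
    by (simp add: algebra_simps eval_nat_numeral)
  then have "c2 * (r * (1 + r) * (1 - r)) = 0" using 4 5 by simp
  then show "c2 = 0" using assms(1,2) by (simp add: add_nonneg_eq_0_iff)
  with 4 1 show "c1 = 0" "c0 = 0" by simp_all
qed

text \<open>
  Either \<open>y\<close> is small against \<open>x\<close>, and then \<open>y - r x\<close> is of order \<open>x\<close>; or the truncation at
  \<open>x\<close> is comparable to that at \<open>y\<close>, and \<open>x\<close> is a combination of the two residuals.
\<close>

lemma truncated_square_bound:
  fixes r x y N :: real
  assumes r: "0 < r" "r < 1" and N: "0 \<le> N"
  shows "r\<^sup>2 * (1 - r\<^sup>2)\<^sup>2 * (min (x\<^sup>2) N * x\<^sup>2) \<le>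
    8 * (min (x\<^sup>2) N * (y - r * x)\<^sup>2 + min (y\<^sup>2) N * (x - r * y)\<^sup>2)"
proof -
  define a b u v where "a = min (x\<^sup>2) N" and "b = min (y\<^sup>2) N"
    and "u = (y - r * x)\<^sup>2" and "v = (x - r * y)\<^sup>2"
  have nn: "0 \<le> a" "0 \<le> b" "0 \<le> u" "0 \<le> v" using N by (auto simp: a_def b_def u_def v_def)
  have r2: "0 < r\<^sup>2" "r\<^sup>2 < 1" using r by (auto simp: power_less_one_iff)
  have "r\<^sup>2 * (1 - r\<^sup>2)\<^sup>2 * (a * x\<^sup>2) \<le> 8 * (a * u + b * v)"
  proof (cases "\<bar>y\<bar> \<le> r / 2 * \<bar>x\<bar>")
    case True
    have "r * \<bar>x\<bar> \<le> \<bar>y - r * x\<bar> + \<bar>y\<bar>"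
      using abs_triangle_ineq4[of "y - r * x" y] r by (simp add: abs_mult)
    then have "\<bar>r / 2 * x\<bar> \<le> \<bar>y - r * x\<bar>" using True r by (simp add: abs_mult)
    then have "(r / 2 * x)\<^sup>2 \<le> u" unfolding u_def by (rule abs_le_square_iff[THEN iffD1])
    then have "r\<^sup>2 * x\<^sup>2 \<le> 4 * u" by (simp add: power_mult_distrib power_divide)
    then have "a * (r\<^sup>2 * x\<^sup>2) \<le> a * (4 * u)" using nn by (intro mult_left_mono)
    moreover have "(1 - r\<^sup>2)\<^sup>2 \<le> 1" using r2 by (intro power_le_one) auto
    then have "(1 - r\<^sup>2)\<^sup>2 * (a * (r\<^sup>2 * x\<^sup>2)) \<le> 1 * (a * (r\<^sup>2 * x\<^sup>2))"
      using nn by (intro mult_right_mono) auto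
    moreover have "0 \<le> a * u" "0 \<le> b * v" using nn by auto
    ultimately show ?thesis by (simp add: mult_ac)
  next
    case False
    then have "\<bar>r / 2 * x\<bar> \<le> \<bar>y\<bar>" using r by (simp add: abs_mult)
    then have "(r / 2 * x)\<^sup>2 \<le> y\<^sup>2" by (rule abs_le_square_iff[THEN iffD1])
    then have 1: "r\<^sup>2 / 4 * x\<^sup>2 \<le> y\<^sup>2" by (simp add: power_mult_distrib power_divide)
    have "r\<^sup>2 / 4 * a \<le> r\<^sup>2 / 4 * x\<^sup>2" unfolding a_def by (intro mult_left_mono) auto
    moreover have "r\<^sup>2 / 4 * a \<le> 1 * N"
      unfolding a_def using r2 N by (intro mult_mono) auto
    ultimately have "r\<^sup>2 / 4 * a \<le> b" using 1 unfolding b_def by simp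
    then have ab: "r\<^sup>2 * a \<le> 4 * b" by simp
    have "(1 - r\<^sup>2) * x = (x - r * y) + r * (y - r * x)"
      by (simp add: algebra_simps power2_eq_square)
    then have "((1 - r\<^sup>2) * x)\<^sup>2 \<le> 2 * (x - r * y)\<^sup>2 + 2 * (r * (y - r * x))\<^sup>2"
      using sum_squares_bound[of "x - r * y" "r * (y - r * x)"] by (simp add: power2_sum)
    also have "(r * (y - r * x))\<^sup>2 \<le> 1 * u"
      unfolding power_mult_distrib u_def using r2 by (intro mult_right_mono) auto
    finally have "(1 - r\<^sup>2)\<^sup>2 * x\<^sup>2 \<le> 2 * v + 2 * u" by (simp add: v_def power_mult_distrib)
    then have "(r\<^sup>2 * a) * ((1 - r\<^sup>2)\<^sup>2 * x\<^sup>2) \<le> (r\<^sup>2 * a) * (2 * v + 2 * u)"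
      using nn by (intro mult_left_mono) auto
    also have "\<dots> = (r\<^sup>2 * a) * (2 * v) + r\<^sup>2 * (2 * (a * u))" by (simp add: algebra_simps)
    also have "\<dots> \<le> (4 * b) * (2 * v) + 1 * (2 * (a * u))"
      using ab nn r2 by (intro add_mono mult_right_mono) auto
    also have "\<dots> \<le> 8 * (a * u + b * v)" using nn by (simp add: algebra_simps)
    finally show ?thesis by (simp add: mult_ac)
  qed
  then show ?thesis by (simp only: a_def b_def u_def v_def)
qed

text \<open>The characteristic roots of the recursion are \<open>r\<close> and \<open>1 / r\<close>.
  Boundedness excludes the growing root, which leaves the geometric solution.\<close>

lemma bounded_two_sided_recursion:
  fixes z :: "nat \<Rightarrow> real"
  assumes r: "0 < r" "r < 1"
    and bnd: "\<And>k. \<bar>z k\<bar> \<le> K"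
    and rec: "\<And>k. z (Suc k) = r / (1 + r\<^sup>2) * (z k + z (Suc (Suc k)))"
  shows "z k = r ^ k * z 0"
proof -
  \<comment> \<open>This combination annihilates the root \<open>r\<close> and isolates the root
    \<open>1 / r\<close>: it grows by the factor \<open>1 / r\<close> at each step, so being bounded
    it must vanish.\<close>
  define w where "w k = z (Suc k) - r * z k" for k
  have "(1 + r\<^sup>2) * z (Suc k) = r * (z k + z (Suc (Suc k)))" for k
    by (subst rec) (simp add: add_nonneg_eq_0_iff)
  then have w: "w k = r * w (Suc k)" for k
    unfolding w_def by (simp add: algebra_simps power2_eq_square)
  have w0: "w 0 = r ^ k * w k" for k
  proof (induction k)
    case (Suc k)
    then show ?case by (subst (asm) (2) w) (simp add: mult_ac)
  qed simp
  have wb: "\<bar>w k\<bar> \<le> 2 * K" for k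
  proof -
    have "\<bar>r * z k\<bar> \<le> 1 * K"
      unfolding abs_mult using r bnd[of k] by (intro mult_mono) auto
    then show ?thesis unfolding w_def using bnd[of "Suc k"] by linarith
  qed
  have le: "\<bar>w 0\<bar> \<le> r ^ k * (2 * K)" for k
    unfolding w0[of k] abs_mult using r wb[of k] by (simp add: mult_left_mono)
  have "(\<lambda>k. r ^ k * (2 * K)) \<longlonglongrightarrow> 0 * (2 * K)"
    using r by (intro tendsto_intros LIMSEQ_realpow_zero) auto
  then have "\<bar>w 0\<bar> \<le> 0" using le by (intro LIMSEQ_le_const) auto
  then have "w k = 0" for k using w0[of k] r by simp
  then have s: "z (Suc k) = r * z k" for k unfolding w_def using r by simp
  show ?thesis by (induction k) (auto simp: s)
qed

section \<open>The two-sided regressions and their time reversal\<close>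

text \<open>The linear coefficient is written as \<open>\<rho> / (1 + \<rho>\<^sup>2)\<close>, the
  value forced by correlations \<rho> at lag 1 and \<open>\<rho>\<^sup>2\<close> at lag 2. In this
  form the associated recursion has the characteristic roots \<rho> and 1/\<rho>.\<close>

locale two_sided_regressions = prob_space M for M :: "'a measure" +
  fixes X :: "int \<Rightarrow> 'a \<Rightarrow> real" and \<rho> A B C D :: real
  assumes X_measurable [measurable]: "X n \<in> borel_measurable M"
    and sq_integrable: "integrable M (\<lambda>x. (X n x)\<^sup>2)"
    and sq_integral: "(\<integral>x. (X n x)\<^sup>2 \<partial>M) = 1"
    and rho: "0 < \<rho>" "\<rho> < 1"
    and linear_regression: "AE x in M. real_cond_exp M (gen_alg M X {k. k \<noteq> n}) (X n) x =
        \<rho> / (1 + \<rho>\<^sup>2) * (X (n - 1) x + X (n + 1) x)"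
    and quadratic_regression:
      "AE x in M. real_cond_exp M (gen_alg M X {k. k \<noteq> n}) (\<lambda>x. (X n x)\<^sup>2) x =
        A * ((X (n - 1) x)\<^sup>2 + (X (n + 1) x)\<^sup>2) + B * X (n - 1) x * X (n + 1) x
        + D * (X (n - 1) x + X (n + 1) x) + C"
begin

text \<open>Both regressions are symmetric in the two neighbours. Interpreting the locale for the
  reversed sequence turns each statement about the past into one about the future.\<close>

lemma reflected: "two_sided_regressions M (\<lambda>n. X (- n)) \<rho> A B C D"
proof -
  have K: "gen_alg M (\<lambda>n. X (- n)) {k. k \<noteq> n} = gen_alg M X {k. k \<noteq> - n}" for n
  proof -
    have "uminus ` {k. k \<noteq> n} = {k. k \<noteq> - n}"
      by (auto simp: image_iff) (metis minus_minus)
    then show ?thesis by (simp add: gen_alg_uminus)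
  qed
  have e: "- n - 1 = - (n + 1)" "- n + 1 = - (n - 1)" for n :: int by simp_all
  show ?thesis
  proof
    fix n
    show "AE x in M. real_cond_exp M (gen_alg M (\<lambda>n. X (- n)) {k. k \<noteq> n}) (X (- n)) x =
        \<rho> / (1 + \<rho>\<^sup>2) * (X (- (n - 1)) x + X (- (n + 1)) x)"
      using linear_regression[of "- n"] unfolding K e by (simp only: add.commute)
    show "AE x in M. real_cond_exp M (gen_alg M (\<lambda>n. X (- n)) {k. k \<noteq> n}) (\<lambda>x. (X (- n) x)\<^sup>2) x =
        A * ((X (- (n - 1)) x)\<^sup>2 + (X (- (n + 1)) x)\<^sup>2) + B * X (- (n - 1)) x * X (- (n + 1)) x
        + D * (X (- (n - 1)) x + X (- (n + 1)) x) + C"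
      using quadratic_regression[of "- n"] unfolding K e
      by (simp only: add.commute mult.commute mult.left_commute)
  qed (use rho sq_integrable sq_integral in auto)
qed

lemma prod_integrable [intro]: "integrable M (\<lambda>x. X i x * X j x)"
  by (rule square_integrable_prod) (auto simp: sq_integrable)

lemma X_integrable [intro]: "integrable M (X n)"
  using sq_integrable by (rule square_integrable_imp_integrable[rotated]) auto

lemma abs_integral_le_1: "(\<integral>x. \<bar>X n x\<bar> \<partial>M) \<le> 1"
proof -
  have "(\<integral>x. \<bar>X n x\<bar> \<partial>M) \<le> (\<integral>x. (1 + (X n x)\<^sup>2) / 2 \<partial>M)"
  proof (rule integral_mono)
    fix x
    show "\<bar>X n x\<bar> \<le> (1 + (X n x)\<^sup>2) / 2"
      using sum_squares_bound[of 1 "\<bar>X n x\<bar>"] by simp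
  qed (use sq_integrable X_integrable in auto)
  also have "\<dots> = 1" using sq_integrable sq_integral by (simp add: prob_space)
  finally show ?thesis .
qed

abbreviation past :: "int \<Rightarrow> 'a measure" where
  "past n \<equiv> gen_alg M X {..n}"

lemma past_measurable_except: "f \<in> borel_measurable (past n) \<Longrightarrow> n < k \<Longrightarrow>
    f \<in> borel_measurable (gen_alg M X {j. j \<noteq> k})"
  by (rule measurable_from_subalg[where F = "past n"]) (auto simp: subalgebra_def intro!: gen_alg_mono)

lemma past_measurable_mono: "f \<in> borel_measurable (past n) \<Longrightarrow> n \<le> k \<Longrightarrow>
    f \<in> borel_measurable (past k)"
  by (rule measurable_from_subalg[where F = "past n"]) (simp_all add: subalgebra_def gen_alg_mono)

lemma subalgebra_gen: "subalgebra M (gen_alg M X K)"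
  by (rule subalgebra_gen_alg) simp

lemma linear_test:
  assumes "g \<in> borel_measurable (gen_alg M X {k. k \<noteq> n})"
    and "integrable M (\<lambda>x. g x * X n x)"
  shows "(\<integral>x. g x * X n x \<partial>M) =
    (\<integral>x. g x * (\<rho> / (1 + \<rho>\<^sup>2) * (X (n - 1) x + X (n + 1) x)) \<partial>M)"
  by (rule real_cond_exp_test[OF subalgebra_gen linear_regression assms(1)]) (use assms in auto)

lemma quadratic_test:
  assumes "g \<in> borel_measurable (gen_alg M X {k. k \<noteq> n})"
    and "integrable M (\<lambda>x. g x * (X n x)\<^sup>2)"
  shows "(\<integral>x. g x * (X n x)\<^sup>2 \<partial>M) =
    (\<integral>x. g x * (A * ((X (n - 1) x)\<^sup>2 + (X (n + 1) x)\<^sup>2) + B * X (n - 1) x * X (n + 1) x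
        + D * (X (n - 1) x + X (n + 1) x) + C) \<partial>M)"
  by (rule real_cond_exp_test[OF subalgebra_gen quadratic_regression assms(1)]) (use assms in auto)

lemma indicator_mult_integrable:
  fixes f :: "'a \<Rightarrow> real"
  assumes "S \<in> sets (gen_alg M X K)" "integrable M f"
  shows "integrable M (\<lambda>x. indicator S x * f x)"
  using integrable_mult_indicator[of S M f] assms subalgebra_gen[of K]
  by (auto simp: subalgebra_def)

section \<open>From two-sided to one-sided regressions\<close>

text \<open>An event of the past of \<open>n\<close> is measurable without any single later
  variable, so it may test the two-sided regression at each later time. The resulting integrals
  solve the recursion of \<open>bounded_two_sided_recursion\<close>, and the unit variance bounds
  them by 1.\<close>

lemma linear_past_event:
  assumes S: "S \<in> sets (past n)"
  shows "(\<integral>x. indicator S x * X (n + int k) x \<partial>M) = \<rho> ^ k * (\<integral>x. indicator S x * X n x \<partial>M)"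
proof -
  define z where "z k = (\<integral>x. indicator S x * X (n + int k) x \<partial>M)" for k
  note I = indicator_mult_integrable[OF S]
  have "z k = \<rho> ^ k * z 0"
  proof (rule bounded_two_sided_recursion[OF rho])
    fix k
    have "\<bar>z k\<bar> \<le> (\<integral>x. \<bar>indicator S x * X (n + int k) x\<bar> \<partial>M)"
      unfolding z_def by (rule integral_abs_bound)
    also have "\<dots> \<le> (\<integral>x. \<bar>X (n + int k) x\<bar> \<partial>M)"
      by (intro integral_mono integrable_abs I X_integrable) (simp add: indicator_def)
    also have "\<dots> \<le> 1" by (rule abs_integral_le_1)
    finally show "\<bar>z k\<bar> \<le> 1" .
    define c where "c = \<rho> / (1 + \<rho>\<^sup>2)"
    define i where "i = n + int k"
    have e: "i + 1 - 1 = i" "i + 1 + 1 = n + int (Suc (Suc k))" "n + int (Suc k) = i + 1"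
      by (auto simp: i_def)
    have "z (Suc k) = (\<integral>x. indicator S x * X (i + 1) x \<partial>M)"
      unfolding z_def e ..
    also have "\<dots> = (\<integral>x. indicator S x * (c * (X (i + 1 - 1) x + X (i + 1 + 1) x)) \<partial>M)"
      unfolding c_def using S
      by (intro linear_test I X_integrable past_measurable_except[of _ n]) (auto simp: i_def)
    also have "\<dots> = (\<integral>x. c * (indicator S x * X i x
        + indicator S x * X (n + int (Suc (Suc k))) x) \<partial>M)"
      unfolding e by (rule Bochner_Integration.integral_cong[OF refl]) (simp only: algebra_simps)
    also have "\<dots> = c * (z k + z (Suc (Suc k)))"
      unfolding integral_mult_right_zero z_def i_def
      by (subst Bochner_Integration.integral_add) (rule I X_integrable refl)+
    finally show "z (Suc k) = \<rho> / (1 + \<rho>\<^sup>2) * (z k + z (Suc (Suc k)))"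
      unfolding c_def .
  qed
  then show ?thesis by (simp add: z_def)
qed

lemma cond_exp_past:
  fixes f g :: "'a \<Rightarrow> real"
  assumes "integrable M f" "integrable M g" "g \<in> borel_measurable (past n)"
    and "\<And>S. S \<in> sets (past n) \<Longrightarrow>
      (\<integral>x. indicator S x * f x \<partial>M) = (\<integral>x. indicator S x * g x \<partial>M)"
  shows "AE x in M. real_cond_exp M (past n) f x = g x"
proof -
  interpret F: finite_measure_subalgebra M "past n"
    using subalgebra_gen by unfold_locales
  show ?thesis
    by (rule F.real_cond_exp_charact) (use assms in \<open>auto simp: set_lebesgue_integral_def\<close>)
qed

lemma linear_past:
  "AE x in M. real_cond_exp M (past n) (X (n + int k)) x = \<rho> ^ k * X n x"
proof (rule cond_exp_past)
  show "(\<lambda>x. \<rho> ^ k * X n x) \<in> borel_measurable (past n)"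
    using measurable_gen_alg[of n "{..n}" X M] by simp
  fix S assume "S \<in> sets (past n)"
  from linear_past_event[OF this, of k]
  show "(\<integral>x. indicator S x * X (n + int k) x \<partial>M) = (\<integral>x. indicator S x * (\<rho> ^ k * X n x) \<partial>M)"
    by (simp only: mult.left_commute[of _ "\<rho> ^ k"] integral_mult_right_zero)
qed auto

lemma linear_past_test:
  assumes "g \<in> borel_measurable (past n)"
    and "integrable M (\<lambda>x. g x * X (n + int k) x)"
  shows "(\<integral>x. g x * X (n + int k) x \<partial>M) = \<rho> ^ k * (\<integral>x. g x * X n x \<partial>M)"
proof -
  have "(\<integral>x. g x * X (n + int k) x \<partial>M) = (\<integral>x. g x * (\<rho> ^ k * X n x) \<partial>M)"
    by (rule real_cond_exp_test[OF subalgebra_gen linear_past assms(1)]) (use assms in auto)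
  then show ?thesis by (simp only: mult.left_commute[of _ "\<rho> ^ k"] integral_mult_right_zero)
qed

text \<open>Two recursions for second moments restricted to \<open>S\<close>. The first compares the
  one-sided and the two-sided linear regression on the product of neighbours at times
  \<open>n + 1\<close> and \<open>n + 2\<close>; the second tests the quadratic regression at
  \<open>n + 1\<close> with the indicator of \<open>S\<close>.\<close>

lemma quadratic_past_event:
  assumes S: "S \<in> sets (past n)"
  defines "u \<equiv> \<lambda>i. (\<integral>x. indicator S x * (X i x)\<^sup>2 \<partial>M)"
    and "z \<equiv> (\<integral>x. indicator S x * X n x \<partial>M)"
  shows "(1 + \<rho>\<^sup>2) * u (n + 1) = \<rho>\<^sup>2 * u n + u (n + 2)"
    and "u (n + 1) = A * (u n + u (n + 2)) + B * \<rho>\<^sup>2 * u n + D * z * (1 + \<rho>\<^sup>2) + C * prob S"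
proof -
  note I = indicator_mult_integrable[OF S]
  have Sm [measurable]: "S \<in> sets M" using S subalgebra_gen by (auto simp: subalgebra_def)
  have P: "(\<integral>x. indicator S x * (X i x * X (i + int j) x) \<partial>M) = \<rho> ^ j * u i" if "n \<le> i" for i j
  proof -
    have m: "(\<lambda>x. indicator S x * X i x) \<in> borel_measurable (past i)"
      using measurable_gen_alg[of i "{..i}" X M] past_measurable_mono[of "indicator S" n i] S that
      by (intro borel_measurable_times) auto
    have "integrable M (\<lambda>x. indicator S x * X i x * X (i + int j) x)"
      using I[OF prod_integrable] by (simp only: mult.assoc)
    from linear_past_test[OF m this]
    show ?thesis unfolding u_def by (simp only: mult.assoc power2_eq_square)
  qed
  have P2: "(\<integral>x. indicator S x * (X n x * X (n + 2) x) \<partial>M) = \<rho>\<^sup>2 * u n"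
    using P[of n 2] by simp
  have P1: "(\<integral>x. indicator S x * (X (n + 1) x * X (n + 2) x) \<partial>M) = \<rho> * u (n + 1)"
    using P[of "n + 1" 1] by (simp add: add.assoc)
  have e: "n + 1 - 1 = n" "n + 1 + 1 = n + 2" by auto
  have Se: "indicator S \<in> borel_measurable (gen_alg M X {j. j \<noteq> n + 1})"
    using S by (intro past_measurable_except[of _ n]) auto
  have X2: "X (n + 2) \<in> borel_measurable (gen_alg M X {j. j \<noteq> n + 1})"
    by (rule measurable_gen_alg) simp
  define c where "c = \<rho> / (1 + \<rho>\<^sup>2)"
  have i1: "integrable M (\<lambda>x. (indicator S x * X (n + 2) x) * X (n + 1) x)"
    unfolding mult.assoc by (rule I[OF prod_integrable])
  have m1: "(\<lambda>x. indicator S x * X (n + 2) x) \<in> borel_measurable (gen_alg M X {j. j \<noteq> n + 1})"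
    by (intro borel_measurable_times Se X2)
  \<comment> \<open>The same integral was found in \<open>P1\<close> by predicting
    \<open>X (n + 2)\<close> from the past; now \<open>X (n + 1)\<close> is replaced by its
    two-sided regression.\<close>
  have "\<rho> * u (n + 1) = (\<integral>x. (indicator S x * X (n + 2) x) * X (n + 1) x \<partial>M)"
    unfolding P1[symmetric] by (simp only: mult_ac)
  also have "\<dots> = (\<integral>x. (indicator S x * X (n + 2) x) * (c * (X n x + X (n + 2) x)) \<partial>M)"
    using linear_test[OF m1 i1] unfolding e c_def .
  also have "\<dots> = (\<integral>x. c * (indicator S x * (X n x * X (n + 2) x) + indicator S x * (X (n + 2) x)\<^sup>2) \<partial>M)"
    by (rule Bochner_Integration.integral_cong[OF refl]) (simp only: algebra_simps power2_eq_square)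
  also have "\<dots> = c * (\<rho>\<^sup>2 * u n + u (n + 2))"
    unfolding integral_mult_right_zero
    by (subst Bochner_Integration.integral_add) (simp only: P2 u_def | rule I prod_integrable sq_integrable)+
  finally have "\<rho> * u (n + 1) = \<rho> * ((\<rho>\<^sup>2 * u n + u (n + 2)) / (1 + \<rho>\<^sup>2))"
    by (simp add: c_def)
  then have "u (n + 1) = (\<rho>\<^sup>2 * u n + u (n + 2)) / (1 + \<rho>\<^sup>2)"
    unfolding mult_cancel_left using rho by simp
  moreover have "1 + \<rho>\<^sup>2 \<noteq> 0" by (simp add: add_nonneg_eq_0_iff)
  ultimately show "(1 + \<rho>\<^sup>2) * u (n + 1) = \<rho>\<^sup>2 * u n + u (n + 2)"
    by simp
  have "u (n + 1) = (\<integral>x. indicator S x * (A * ((X n x)\<^sup>2 + (X (n + 2) x)\<^sup>2)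
      + B * X n x * X (n + 2) x + D * (X n x + X (n + 2) x) + C) \<partial>M)"
    using quadratic_test[OF Se I[OF sq_integrable]] unfolding u_def e .
  also have "\<dots> = (\<integral>x. A * (indicator S x * (X n x)\<^sup>2 + indicator S x * (X (n + 2) x)\<^sup>2)
      + B * (indicator S x * (X n x * X (n + 2) x))
      + D * (indicator S x * X n x + indicator S x * X (n + 2) x) + C * indicator S x \<partial>M)"
    by (rule Bochner_Integration.integral_cong[OF refl]) (simp only: algebra_simps)
  also have "\<dots> = A * (u n + u (n + 2)) + B * (\<integral>x. indicator S x * (X n x * X (n + 2) x) \<partial>M)
      + D * ((\<integral>x. indicator S x * X n x \<partial>M) + (\<integral>x. indicator S x * X (n + 2) x \<partial>M)) + C * prob S"
    unfolding u_def
    using I[OF sq_integrable, of n] I[OF sq_integrable, of "n + 2"]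
      I[OF prod_integrable, of n "n + 2"] I[OF X_integrable, of n] I[OF X_integrable, of "n + 2"]
    by (simp add: emeasure_eq_measure)
  also have "(\<integral>x. indicator S x * X (n + 2) x \<partial>M) = \<rho>\<^sup>2 * z"
    using linear_past_event[OF S, of 2] by (simp add: z_def)
  finally show "u (n + 1) = A * (u n + u (n + 2)) + B * \<rho>\<^sup>2 * u n + D * z * (1 + \<rho>\<^sup>2) + C * prob S"
    unfolding P2 z_def[symmetric] by (simp add: algebra_simps)
qed

text \<open>The first recursion has the characteristic roots 1 and \<open>\<rho>\<^sup>2\<close>,
  and \<beta> is the weight of the second root, read off from times 0 and 1. Substituting this
  solution into the quadratic recursion gives a combination of 1, \<open>\<rho> ^ k\<close> and
  \<open>\<rho> ^ (2 * k)\<close> that vanishes for all k, so each coefficient is zero.\<close>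

lemma past_event_closed_form:
  assumes S: "S \<in> sets (past n)"
  defines "u \<equiv> \<lambda>k. (\<integral>x. indicator S x * (X (n + int k) x)\<^sup>2 \<partial>M)"
    and "z \<equiv> (\<integral>x. indicator S x * X n x \<partial>M)"
  defines "\<beta> \<equiv> (u 0 - u 1) / (1 - \<rho>\<^sup>2)"
  shows "u k = (u 0 - \<beta>) + \<beta> * \<rho> ^ (2 * k)"
    and "(u 0 - \<beta>) * (1 - 2 * A - B * \<rho>\<^sup>2) = C * prob S"
    and "D * z = 0"
    and "\<beta> * (\<rho>\<^sup>2 - A * (1 + \<rho> ^ 4) - B * \<rho>\<^sup>2) = 0"
proof -
  have S': "S \<in> sets (past (n + int j))" for j
    using S gen_alg_mono[of "{..n}" "{..n + int j}" M X] by auto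
  have rec: "(1 + \<rho>\<^sup>2) * u (j + 1) = \<rho>\<^sup>2 * u j + u (j + 2)" for j
    using quadratic_past_event(1)[OF S', of j] by (simp add: u_def ac_simps)
  have quad: "u (j + 1) = A * (u j + u (j + 2)) + B * \<rho>\<^sup>2 * u j
      + D * (\<rho> ^ j * z) * (1 + \<rho>\<^sup>2) + C * prob S" for j
    using quadratic_past_event(2)[OF S', of j] linear_past_event[OF S, of j]
    by (simp add: u_def z_def ac_simps)
  have r1: "1 - \<rho>\<^sup>2 \<noteq> 0"
    using rho by (simp add: power2_eq_1_iff)
  have b: "\<beta> * (1 - \<rho>\<^sup>2) = u 0 - u 1" unfolding \<beta>_def using r1 by simp
  have uk: "u k = (u 0 - \<beta>) + \<beta> * \<rho> ^ (2 * k)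
      \<and> u (k + 1) = (u 0 - \<beta>) + \<beta> * \<rho> ^ (2 * (k + 1))" for k
  proof (induction k)
    case 0
    then show ?case using b by (simp add: algebra_simps power2_eq_square)
  next
    case (Suc k)
    define t where "t = \<rho> ^ (2 * k)"
    have p: "\<rho> ^ (2 * (k + 1)) = t * \<rho>\<^sup>2" "\<rho> ^ (2 * (k + 2)) = t * \<rho>\<^sup>2 * \<rho>\<^sup>2"
      by (simp_all add: t_def power_add power2_eq_square)
    have u: "u k = (u 0 - \<beta>) + \<beta> * t" "u (k + 1) = (u 0 - \<beta>) + \<beta> * (t * \<rho>\<^sup>2)"
      using Suc unfolding p t_def[symmetric] by auto
    have "u (k + 2) = (1 + \<rho>\<^sup>2) * u (k + 1) - \<rho>\<^sup>2 * u k" using rec[of k] by simp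
    also have "\<dots> = (1 + \<rho>\<^sup>2) * ((u 0 - \<beta>) + \<beta> * (t * \<rho>\<^sup>2)) - \<rho>\<^sup>2 * ((u 0 - \<beta>) + \<beta> * t)"
      by (simp only: u)
    also have "\<dots> = (u 0 - \<beta>) + \<beta> * (t * \<rho>\<^sup>2 * \<rho>\<^sup>2)"
      by (simp add: algebra_simps)
    finally have "u (k + 2) = (u 0 - \<beta>) + \<beta> * \<rho> ^ (2 * (k + 2))" unfolding p .
    with Suc show ?case by simp
  qed
  then show "u k = (u 0 - \<beta>) + \<beta> * \<rho> ^ (2 * k)" by blast
  \<comment> \<open>The recursion at time \<open>j\<close> is read at exponent k = j + 1, where the
    Vandermonde lemma starts; this shift causes the divisions by \<rho> and
    \<open>\<rho>\<^sup>2\<close>.\<close>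
  define c0 c1 c2 where "c0 = (u 0 - \<beta>) * (1 - 2 * A - B * \<rho>\<^sup>2) - C * prob S"
    and "c1 = - (D * z * (1 + \<rho>\<^sup>2)) / \<rho>"
    and "c2 = \<beta> * (\<rho>\<^sup>2 - A * (1 + \<rho> ^ 4) - B * \<rho>\<^sup>2) / \<rho>\<^sup>2"
  have "c0 + c1 * \<rho> ^ k + c2 * \<rho> ^ (2 * k) = 0" if pos: "1 \<le> k" for k
  proof -
    obtain j where j: "k = j + 1" using pos by (cases k) auto
    define s t where "s = \<rho> ^ j" and "t = \<rho> ^ (2 * j)"
    have p: "\<rho> ^ k = s * \<rho>" "\<rho> ^ (2 * k) = t * \<rho>\<^sup>2"
      by (simp_all add: j s_def t_def power_add power2_eq_square)
    have p': "\<rho> ^ (2 * (j + 1)) = t * \<rho>\<^sup>2" "\<rho> ^ (2 * (j + 1 + 1)) = t * \<rho> ^ 4"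
      by (simp_all add: t_def power_add power2_eq_square power4_eq_xxxx)
    have u: "u j = (u 0 - \<beta>) + \<beta> * t" "u (j + 1) = (u 0 - \<beta>) + \<beta> * (t * \<rho>\<^sup>2)"
      "u (j + 2) = (u 0 - \<beta>) + \<beta> * (t * \<rho> ^ 4)"
      using uk[of j] uk[of "j + 1"] unfolding p' t_def[symmetric] by auto
    have c: "c1 * (s * \<rho>) = - (D * z * (1 + \<rho>\<^sup>2)) * s"
      "c2 * (t * \<rho>\<^sup>2) = \<beta> * (\<rho>\<^sup>2 - A * (1 + \<rho> ^ 4) - B * \<rho>\<^sup>2) * t"
      using rho by (simp_all add: c1_def c2_def)
    show ?thesis unfolding p c c0_def using quad[of j] unfolding u s_def[symmetric]
      by (simp add: algebra_simps)
  qed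
  from vandermonde_powers_eq_0[OF rho this]
  have "c0 = 0" "c1 = 0" "c2 = 0" by auto
  moreover have "1 + \<rho>\<^sup>2 \<noteq> 0" by (simp add: add_nonneg_eq_0_iff)
  ultimately show "(u 0 - \<beta>) * (1 - 2 * A - B * \<rho>\<^sup>2) = C * prob S" "D * z = 0"
    "\<beta> * (\<rho>\<^sup>2 - A * (1 + \<rho> ^ 4) - B * \<rho>\<^sup>2) = 0"
    using rho by (simp_all add: c0_def c1_def c2_def)
qed

section \<open>Relations among the constants of the quadratic regression\<close>

text \<open>On the whole space every second moment is 1, so \<beta> = 0 and the comparison of
  constant terms becomes this identity.\<close>

lemma C_eq: "C = 1 - 2 * A - B * \<rho>\<^sup>2"
proof -
  have "space M \<in> sets (past 0)"
    using sets.top[of "past 0"] by simp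
  moreover have "(\<integral>x. indicator (space M) x * (X k x)\<^sup>2 \<partial>M) = 1" for k
    using sq_integral[of k] by (subst Bochner_Integration.integral_cong[OF refl]) auto
  ultimately show ?thesis
    using past_event_closed_form(2)[of "space M" 0] by (simp add: prob_space)
qed

lemma past_AE_eq:
  fixes f g :: "'a \<Rightarrow> real"
  assumes f: "integrable M f" "f \<in> borel_measurable (past n)"
    and g: "integrable M g" "g \<in> borel_measurable (past n)"
    and "\<And>S. S \<in> sets (past n) \<Longrightarrow>
      (\<integral>x. indicator S x * f x \<partial>M) = (\<integral>x. indicator S x * g x \<partial>M)"
  shows "AE x in M. f x = g x"
proof -
  interpret F: finite_measure_subalgebra M "past n"
    using subalgebra_gen by unfold_locales
  show ?thesis
    using F.real_cond_exp_F_meas[OF f] cond_exp_past[OF f(1) g assms(5)] by auto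
qed

lemma X_past_measurable [measurable]: "X n \<in> borel_measurable (past n)"
  by (rule measurable_gen_alg) simp

text \<open>Otherwise \<open>X 0\<close> would integrate to zero over every event of its past, hence
  vanish almost surely, against its unit variance.\<close>

lemma D_eq_0: "D = 0"
proof (rule ccontr)
  assume "D \<noteq> 0"
  then have "AE x in M. X 0 x = 0"
    using past_event_closed_form(3)[of _ 0]
    by (intro past_AE_eq[of _ 0]) auto
  then have "(\<integral>x. (X 0 x)\<^sup>2 \<partial>M) = 0"
    by (intro integral_eq_zero_AE) auto
  then show False using sq_integral[of 0] by simp
qed

section \<open>The degenerate case, in which the squares are constant in time\<close>

text \<open>The assumption says that \<beta> = 0 for every past event; the constant-term relation of
  \<open>past_event_closed_form\<close> then holds with the full second moment in place of its
  constant part.\<close>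

lemma C_sq_eq_C:
  assumes "\<And>S. S \<in> sets (past n) \<Longrightarrow> (\<integral>x. indicator S x * (X (n + 1) x)\<^sup>2 \<partial>M) =
    (\<integral>x. indicator S x * (X n x)\<^sup>2 \<partial>M)"
  shows "AE x in M. C * (X n x)\<^sup>2 = C"
proof (rule past_AE_eq[of _ n])
  fix S assume S: "S \<in> sets (past n)"
  then have "S \<in> sets M" using subalgebra_gen by (auto simp: subalgebra_def)
  moreover have "(\<integral>x. indicator S x * (X n x)\<^sup>2 \<partial>M) * C = C * prob S"
    using past_event_closed_form(2)[OF S] assms[OF S] unfolding C_eq[symmetric] by simp
  ultimately show "(\<integral>x. indicator S x * (C * (X n x)\<^sup>2) \<partial>M) = (\<integral>x. indicator S x * C \<partial>M)"
    by (simp only: mult.left_commute[of _ C] integral_mult_right_zero)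
      (simp add: mult.commute emeasure_eq_measure)
qed (use sq_integrable in auto)

lemma bounded_mult_integrable:
  assumes "f \<in> borel_measurable M" "\<And>x. \<bar>f x\<bar> \<le> K" "integrable M (h :: 'a \<Rightarrow> real)"
  shows "integrable M (\<lambda>x. f x * h x)"
proof (rule Bochner_Integration.integrable_bound)
  show "integrable M (\<lambda>x. K * h x)" using assms(3) by simp
  have "\<bar>f x\<bar> \<le> \<bar>K\<bar>" for x using assms(2)[of x] by linarith
  then show "AE x in M. norm (f x * h x) \<le> norm (K * h x)"
    by (intro AE_I2) (auto simp: abs_mult intro!: mult_right_mono)
qed (use assms in auto)

lemma arctan_integrable: "integrable M (\<lambda>x. arctan ((X i x)\<^sup>2) * (X j x)\<^sup>2)"
proof (rule bounded_mult_integrable)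
  fix x
  show "\<bar>arctan ((X i x)\<^sup>2)\<bar> \<le> pi / 2"
    using arctan_bounded[of "(X i x)\<^sup>2"] by linarith
qed (use sq_integrable in auto)

text \<open>A nonzero factor in the last relation of \<open>past_event_closed_form\<close> forces
  \<beta> = 0. This makes the squares a martingale.\<close>

lemma degenerate_sq_eq:
  assumes nz: "\<rho>\<^sup>2 - A * (1 + \<rho> ^ 4) - B * \<rho>\<^sup>2 \<noteq> 0"
    and that: "S \<in> sets (past n)"
  shows "(\<integral>x. indicator S x * (X (n + 1) x)\<^sup>2 \<partial>M) = (\<integral>x. indicator S x * (X n x)\<^sup>2 \<partial>M)"
proof -
  have "1 - \<rho>\<^sup>2 \<noteq> 0" using rho by (simp add: power2_eq_1_iff)
  then show ?thesis using past_event_closed_form(4)[OF that] nz by simp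
qed

lemma degenerate_arctan:
  assumes "\<rho>\<^sup>2 - A * (1 + \<rho> ^ 4) - B * \<rho>\<^sup>2 \<noteq> 0"
  shows "(\<integral>x. arctan ((X n x)\<^sup>2) * (X (n + 1) x)\<^sup>2 \<partial>M) =
      (\<integral>x. arctan ((X n x)\<^sup>2) * (X n x)\<^sup>2 \<partial>M)"
proof (rule real_cond_exp_test[of "past n"])
  show "AE x in M. real_cond_exp M (past n) (\<lambda>x. (X (n + 1) x)\<^sup>2) x = (X n x)\<^sup>2"
    by (rule cond_exp_past) (use sq_integrable degenerate_sq_eq[OF assms] in auto)
  show "integrable M (\<lambda>x. arctan ((X n x)\<^sup>2) * (X (n + 1) x)\<^sup>2)"
    by (rule arctan_integrable)
qed (auto intro: subalgebra_gen)

text \<open>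
  In the degenerate case the squares form a martingale in both directions of time.  Testing with the
  bounded strictly increasing \<open>arctan\<close> shows that such a process is constant.
\<close>

lemma degenerate_AE_sq_eq:
  assumes nz: "\<rho>\<^sup>2 - A * (1 + \<rho> ^ 4) - B * \<rho>\<^sup>2 \<noteq> 0"
  shows "AE x in M. (X (n + 1) x)\<^sup>2 = (X n x)\<^sup>2"
proof -
  interpret R: two_sided_regressions M "\<lambda>n. X (- n)" \<rho> A B C D by (rule reflected)
  define f where "f i x = (X i x)\<^sup>2" for i x
  note I = arctan_integrable[folded f_def]
  have eq: "(\<integral>x. arctan (f n x) * f (n + 1) x \<partial>M) = (\<integral>x. arctan (f n x) * f n x \<partial>M)"
    "(\<integral>x. arctan (f (n + 1) x) * f n x \<partial>M) = (\<integral>x. arctan (f (n + 1) x) * f (n + 1) x \<partial>M)"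
    using degenerate_arctan[OF nz, of n] R.degenerate_arctan[OF nz, of "- (n + 1)"]
    by (simp_all add: f_def add.commute)
  define h where "h x = (arctan (f n x) - arctan (f (n + 1) x)) * (f n x - f (n + 1) x)" for x
  have h: "h x = arctan (f n x) * f n x - arctan (f n x) * f (n + 1) x
      - arctan (f (n + 1) x) * f n x + arctan (f (n + 1) x) * f (n + 1) x" for x
    unfolding h_def by (simp only: algebra_simps)
  have "integrable M h" "(\<integral>x. h x \<partial>M) = 0"
    unfolding h using I eq by simp_all
  moreover have "0 \<le> h x" for x
    unfolding h_def by (cases "f n x \<le> f (n + 1) x")
      (auto intro: mult_nonpos_nonpos mult_nonneg_nonneg simp: arctan_le_iff)
  ultimately have "AE x in M. h x = 0"
    by (subst (asm) integral_nonneg_eq_0_iff_AE) auto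
  then show ?thesis
    unfolding h_def f_def by eventually_elim (auto simp: arctan_eq_iff)
qed

text \<open>Its purpose is to exclude the degenerate case: with \<open>B = 0\<close> the parameter q
  equals -1. If \<open>B\<close> were nonzero, the constancy of the squares together with the
  quadratic regression at time 1 would force \<open>X 0\<close> to vanish.\<close>

lemma degenerate_B_eq_0:
  assumes nz: "\<rho>\<^sup>2 - A * (1 + \<rho> ^ 4) - B * \<rho>\<^sup>2 \<noteq> 0"
  shows "B = 0"
proof (rule ccontr)
  assume B: "B \<noteq> 0"
  let ?F = "gen_alg M X {k. k \<noteq> 1}"
  interpret F: finite_measure_subalgebra M ?F
    using subalgebra_gen by unfold_locales
  have m [measurable]: "X 0 \<in> borel_measurable ?F"
    by (rule measurable_gen_alg) simp
  have "AE x in M. real_cond_exp M ?F (\<lambda>x. (X 1 x)\<^sup>2) x = real_cond_exp M ?F (\<lambda>x. (X 0 x)\<^sup>2) x"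
    using degenerate_AE_sq_eq[OF nz, of 0] by (intro F.real_cond_exp_cong) auto
  moreover have "AE x in M. real_cond_exp M ?F (\<lambda>x. (X 0 x)\<^sup>2) x = (X 0 x)\<^sup>2"
    by (rule F.real_cond_exp_F_meas) (use sq_integrable in auto)
  moreover have "AE x in M. C * (X 0 x)\<^sup>2 = C"
    by (rule C_sq_eq_C) (rule degenerate_sq_eq[OF nz])
  moreover note quadratic_regression[of 1] degenerate_AE_sq_eq[OF nz, of 0]
    degenerate_AE_sq_eq[OF nz, of 1]
  ultimately have "AE x in M. (X 0 x)\<^sup>2 = 0"
  proof eventually_elim
    fix x
    assume a: "real_cond_exp M ?F (\<lambda>x. (X 1 x)\<^sup>2) x = real_cond_exp M ?F (\<lambda>x. (X 0 x)\<^sup>2) x"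
      "real_cond_exp M ?F (\<lambda>x. (X 0 x)\<^sup>2) x = (X 0 x)\<^sup>2" "C * (X 0 x)\<^sup>2 = C"
      "real_cond_exp M ?F (\<lambda>x. (X 1 x)\<^sup>2) x =
        A * ((X (1 - 1) x)\<^sup>2 + (X (1 + 1) x)\<^sup>2) + B * X (1 - 1) x * X (1 + 1) x
        + D * (X (1 - 1) x + X (1 + 1) x) + C"
      "(X (0 + 1) x)\<^sup>2 = (X 0 x)\<^sup>2" "(X (1 + 1) x)\<^sup>2 = (X 1 x)\<^sup>2"
    \<comment> \<open>As all squares agree, \<open>w\<close> is \<open>s\<close> up to sign, whereas
      the quadratic regression gives w = \<open>\<rho>\<^sup>2 * s\<close>. Since 0 < \<rho> < 1,
      both can hold only for s = 0.\<close>
    define s w where "s = (X 0 x)\<^sup>2" and "w = X 0 x * X 2 x"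
    have s2: "(X 2 x)\<^sup>2 = s" and Cs: "C * s = C" using a(3,5,6) by (simp_all add: s_def)
    then have w2: "w\<^sup>2 = s\<^sup>2" by (simp add: w_def power_mult_distrib s_def power2_eq_square)
    have "s = A * (s + s) + B * w + C"
      using a(1,2,4) s2 D_eq_0 by (simp add: s_def w_def mult.assoc)
    moreover have "B * (w - \<rho>\<^sup>2 * s) = (A * (s + s) + B * w + C * s) - s"
      unfolding C_eq by (simp add: algebra_simps)
    ultimately have "B * (w - \<rho>\<^sup>2 * s) = 0" unfolding Cs by simp
    then have "w = \<rho>\<^sup>2 * s" using B by simp
    then have "(1 - \<rho> ^ 4) * s\<^sup>2 = 0"
      using w2 by (simp add: algebra_simps power_mult_distrib)
    moreover have "\<rho> ^ 4 < 1" using rho by (simp add: power_less_one_iff)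
    ultimately show "(X 0 x)\<^sup>2 = 0" by (simp add: s_def)
  qed
  then have "(\<integral>x. (X 0 x)\<^sup>2 \<partial>M) = 0"
    by (rule integral_eq_zero_AE)
  then show False using sq_integral[of 0] by simp
qed

end

section \<open>The conditional second moment and finiteness of the fourth moment\<close>

locale nondegenerate_regressions = two_sided_regressions +
  assumes C_nonzero: "C \<noteq> 0"
begin

lemma nondegenerate_reflected: "nondegenerate_regressions M (\<lambda>n. X (- n)) \<rho> A B C D"
  by (simp add: nondegenerate_regressions_def nondegenerate_regressions_axioms_def reflected C_nonzero)

text \<open>The constant part \<open>u 0 - \<beta>\<close> of the closed form is known only through
  its product with \<open>C\<close>, which is \<open>C * prob S\<close>. Cancelling the nonzero
  \<open>C\<close> identifies it as \<open>prob S\<close> and thereby fixes both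
  coefficients.\<close>

lemma quadratic_past:
  "AE x in M. real_cond_exp M (past n) (\<lambda>x. (X (n + int k) x)\<^sup>2) x =
    \<rho> ^ (2 * k) * (X n x)\<^sup>2 + (1 - \<rho> ^ (2 * k))"
proof (rule cond_exp_past)
  fix S assume S: "S \<in> sets (past n)"
  define u where "u k = (\<integral>x. indicator S x * (X (n + int k) x)\<^sup>2 \<partial>M)" for k
  define b where "b = (u 0 - u 1) / (1 - \<rho>\<^sup>2)"
  have Sm [measurable]: "S \<in> sets M" using S subalgebra_gen by (auto simp: subalgebra_def)
  have "u k = (u 0 - b) + b * \<rho> ^ (2 * k)" "(u 0 - b) * C = C * prob S"
    using past_event_closed_form(1,2)[OF S] unfolding C_eq[symmetric] u_def b_def by simp_all
  moreover from this(2) have "u 0 - b = prob S"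
    using C_nonzero by (simp add: mult.commute)
  then have "b = u 0 - prob S" by simp
  ultimately have "u k = \<rho> ^ (2 * k) * u 0 + (1 - \<rho> ^ (2 * k)) * prob S"
    by (simp add: algebra_simps)
  moreover have "(\<integral>x. indicator S x * (r * (X n x)\<^sup>2 + t) \<partial>M) = r * u 0 + t * prob S" for r t
  proof -
    have "(\<integral>x. indicator S x * (r * (X n x)\<^sup>2 + t) \<partial>M) =
        (\<integral>x. r * (indicator S x * (X n x)\<^sup>2) + t * indicator S x \<partial>M)"
      by (simp only: algebra_simps)
    also have "\<dots> = r * u 0 + t * prob S"
      using indicator_mult_integrable[OF S sq_integrable, of n]
      by (simp add: u_def emeasure_eq_measure)
    finally show ?thesis .
  qed
  ultimately show "(\<integral>x. indicator S x * (X (n + int k) x)\<^sup>2 \<partial>M) =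
      (\<integral>x. indicator S x * (\<rho> ^ (2 * k) * (X n x)\<^sup>2 + (1 - \<rho> ^ (2 * k))) \<partial>M)"
    by (simp only: u_def)
qed (use sq_integrable in auto)

lemma quadratic_past_test:
  assumes "g \<in> borel_measurable (past n)"
    and "integrable M (\<lambda>x. g x * (X (n + int k) x)\<^sup>2)" "integrable M g"
      "integrable M (\<lambda>x. g x * (X n x)\<^sup>2)"
  shows "(\<integral>x. g x * (X (n + int k) x)\<^sup>2 \<partial>M) =
    \<rho> ^ (2 * k) * (\<integral>x. g x * (X n x)\<^sup>2 \<partial>M) + (1 - \<rho> ^ (2 * k)) * (\<integral>x. g x \<partial>M)"
proof -
  define r where "r = \<rho> ^ (2 * k)"
  have "(\<integral>x. g x * (X (n + int k) x)\<^sup>2 \<partial>M) = (\<integral>x. g x * (r * (X n x)\<^sup>2 + (1 - r)) \<partial>M)"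
    unfolding r_def by (rule real_cond_exp_test[OF subalgebra_gen quadratic_past assms(1)]) (use assms in auto)
  also have "\<dots> = (\<integral>x. r * (g x * (X n x)\<^sup>2) + (1 - r) * g x \<partial>M)"
    by (simp only: distrib_left mult.left_commute mult.commute)
  also have "\<dots> = r * (\<integral>x. g x * (X n x)\<^sup>2 \<partial>M) + (1 - r) * (\<integral>x. g x \<partial>M)"
    using assms(3,4) by simp
  finally show ?thesis unfolding r_def .
qed

lemma truncated_integrable:
  assumes "0 \<le> N" "integrable M h"
  shows "integrable M (\<lambda>x. min ((X i x)\<^sup>2) N * h x)"
  by (rule bounded_mult_integrable[of _ N]) (use assms in auto)

text \<open>Given the past, the residual has the constant conditional variance
  \<open>1 - \<rho>\<^sup>2\<close>. A weight depending only on \<open>X n\<close> therefore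
  contributes just its mean, at most the second moment 1; truncating the weight keeps all integrals
  finite.\<close>

lemma truncated_increment_le:
  assumes N: "0 \<le> N"
  shows "integrable M (\<lambda>x. min ((X n x)\<^sup>2) N * (X (n + 1) x - \<rho> * X n x)\<^sup>2)"
    and "(\<integral>x. min ((X n x)\<^sup>2) N * (X (n + 1) x - \<rho> * X n x)\<^sup>2 \<partial>M) \<le> 1"
proof -
  define g where "g x = min ((X n x)\<^sup>2) N" for x
  note I = truncated_integrable[OF N, of _ n, folded g_def]
  have g [measurable]: "g \<in> borel_measurable (past n)" "g \<in> borel_measurable M"
    unfolding g_def by measurable
  have gi: "integrable M g" using I[of "\<lambda>_. 1"] by simp
  have lin: "(\<integral>x. g x * (X n x * X (n + 1) x) \<partial>M) = \<rho> * (\<integral>x. g x * (X n x)\<^sup>2 \<partial>M)"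
    using linear_past_test[of "\<lambda>x. g x * X n x" n 1] I[OF prod_integrable]
    by (simp add: mult.assoc power2_eq_square)
  have quad: "(\<integral>x. g x * (X (n + 1) x)\<^sup>2 \<partial>M) =
      \<rho>\<^sup>2 * (\<integral>x. g x * (X n x)\<^sup>2 \<partial>M) + (1 - \<rho>\<^sup>2) * (\<integral>x. g x \<partial>M)"
    using quadratic_past_test[of g n 1] I[OF sq_integrable] gi by simp
  have ex: "g x * (X (n + 1) x - \<rho> * X n x)\<^sup>2 = g x * (X (n + 1) x)\<^sup>2
      - 2 * \<rho> * (g x * (X n x * X (n + 1) x)) + \<rho>\<^sup>2 * (g x * (X n x)\<^sup>2)" for x
    by (simp add: power2_eq_square algebra_simps)
  have "integrable M (\<lambda>x. g x * (X (n + 1) x - \<rho> * X n x)\<^sup>2)"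
    unfolding ex using I[OF sq_integrable, of "n + 1"] I[OF sq_integrable, of n]
      I[OF prod_integrable, of n "n + 1"] by auto
  then show "integrable M (\<lambda>x. min ((X n x)\<^sup>2) N * (X (n + 1) x - \<rho> * X n x)\<^sup>2)"
    unfolding g_def .
  have "(\<integral>x. g x * (X (n + 1) x - \<rho> * X n x)\<^sup>2 \<partial>M) = (\<integral>x. g x * (X (n + 1) x)\<^sup>2 \<partial>M)
      - 2 * \<rho> * (\<integral>x. g x * (X n x * X (n + 1) x) \<partial>M) + \<rho>\<^sup>2 * (\<integral>x. g x * (X n x)\<^sup>2 \<partial>M)"
    unfolding ex using I[OF sq_integrable, of "n + 1"] I[OF sq_integrable, of n]
      I[OF prod_integrable, of n "n + 1"] by simp
  also have "\<dots> = (1 - \<rho>\<^sup>2) * (\<integral>x. g x \<partial>M)"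
    unfolding lin quad by (simp add: algebra_simps power2_eq_square)
  also have "\<dots> \<le> 1 * 1"
  proof (rule mult_mono)
    have "(\<integral>x. g x \<partial>M) \<le> (\<integral>x. (X n x)\<^sup>2 \<partial>M)"
      by (rule integral_mono) (use gi sq_integrable in \<open>auto simp: g_def\<close>)
    then show "(\<integral>x. g x \<partial>M) \<le> 1" using sq_integral by simp
    show "0 \<le> (\<integral>x. g x \<partial>M)" by (rule integral_nonneg_AE) (auto simp: g_def N)
  qed auto
  finally show "(\<integral>x. min ((X n x)\<^sup>2) N * (X (n + 1) x - \<rho> * X n x)\<^sup>2 \<partial>M) \<le> 1"
    by (simp add: g_def)
qed

text \<open>\<open>truncated_square_bound\<close> dominates the integrand by weighted forward and
  backward residuals. \<open>truncated_increment_le\<close> and its time reversal bound each of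
  these by 1, uniformly in the truncation level.\<close>

lemma truncated_fourth_moment_le:
  assumes N: "0 \<le> N"
  shows "(\<integral>x. min ((X n x)\<^sup>2) N * (X n x)\<^sup>2 \<partial>M) \<le> 16 / (\<rho>\<^sup>2 * (1 - \<rho>\<^sup>2)\<^sup>2)"
proof -
  interpret R: nondegenerate_regressions M "\<lambda>n. X (- n)" \<rho> A B C D
    by (rule nondegenerate_reflected)
  define f g where "f x = min ((X n x)\<^sup>2) N * (X (n + 1) x - \<rho> * X n x)\<^sup>2"
    and "g x = min ((X (n + 1) x)\<^sup>2) N * (X n x - \<rho> * X (n + 1) x)\<^sup>2" for x
  have f: "integrable M f" "(\<integral>x. f x \<partial>M) \<le> 1"
    unfolding f_def using truncated_increment_le[OF N] by auto
  have e: "- (- (n + 1)) = n + 1" "- (- (n + 1) + 1) = n" by auto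
  have g: "integrable M g" "(\<integral>x. g x \<partial>M) \<le> 1"
    unfolding g_def using R.truncated_increment_le[OF N, of "- (n + 1)"] unfolding e by auto
  define c where "c = \<rho>\<^sup>2 * (1 - \<rho>\<^sup>2)\<^sup>2"
  have "\<rho>\<^sup>2 < 1" using rho by (simp add: power_less_one_iff)
  then have c: "0 < c" unfolding c_def using rho by simp
  have "c * (\<integral>x. min ((X n x)\<^sup>2) N * (X n x)\<^sup>2 \<partial>M) =
      (\<integral>x. c * (min ((X n x)\<^sup>2) N * (X n x)\<^sup>2) \<partial>M)" by simp
  also have "\<dots> \<le> (\<integral>x. 8 * (f x + g x) \<partial>M)"
  proof (rule integral_mono)
    show "integrable M (\<lambda>x. c * (min ((X n x)\<^sup>2) N * (X n x)\<^sup>2))"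
      by (intro integrable_mult_right truncated_integrable N sq_integrable)
    show "integrable M (\<lambda>x. 8 * (f x + g x))" using f g by auto
    show "c * (min ((X n x)\<^sup>2) N * (X n x)\<^sup>2) \<le> 8 * (f x + g x)" for x
      unfolding c_def f_def g_def by (rule truncated_square_bound[OF rho N])
  qed
  also have "\<dots> \<le> 16" using f g by simp
  finally show ?thesis unfolding c_def[symmetric] using c by (simp add: field_simps)
qed

text \<open>The uniform bound on the truncated moments passes to the limit by monotone convergence;
  at each point the truncated values are eventually constant.\<close>

lemma fourth_moment_integrable: "integrable M (\<lambda>x. (X n x) ^ 4)"
proof -
  define f where "f i x = min ((X n x)\<^sup>2) (real i) * (X n x)\<^sup>2" for i x
  have fi: "integrable M (f i)" for i
    unfolding f_def by (rule truncated_integrable) (auto simp: sq_integrable)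
  have mono: "f i x \<le> f j x" if "i \<le> j" for i j x
    unfolding f_def using that by (intro mult_right_mono) auto
  have "incseq (\<lambda>i. \<integral>x. f i x \<partial>M)"
    by (rule incseq_SucI) (auto intro!: integral_mono fi mono)
  moreover have "(\<integral>x. f i x \<partial>M) \<le> 16 / (\<rho>\<^sup>2 * (1 - \<rho>\<^sup>2)\<^sup>2)" for i
    unfolding f_def by (rule truncated_fourth_moment_le) simp
  ultimately obtain L where L: "(\<lambda>i. \<integral>x. f i x \<partial>M) \<longlonglongrightarrow> L"
    using incseq_convergent by blast
  show ?thesis
  proof (rule integral_monotone_convergence_nonneg(1)[OF fi _ _ _ L])
    show "AE x in M. (\<lambda>i. f i x) \<longlonglongrightarrow> (X n x) ^ 4"
    proof (rule AE_I2)
      fix x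
      have "f i x = (X n x) ^ 4" if "nat \<lceil>(X n x)\<^sup>2\<rceil> \<le> i" for i
      proof -
        have "(X n x)\<^sup>2 \<le> real i" using that by linarith
        then show ?thesis by (simp add: f_def power2_eq_square power4_eq_xxxx mult.assoc)
      qed
      then show "(\<lambda>i. f i x) \<longlonglongrightarrow> (X n x) ^ 4"
        by (intro tendsto_eventually eventually_sequentiallyI)
    qed
  qed (auto simp: mono_def intro: mono, auto simp: f_def)
qed

lemma prod4_integrable: "integrable M (\<lambda>x. X i x * X j x * (X k x * X l x))"
proof (rule Bochner_Integration.integrable_bound)
  show "integrable M (\<lambda>x. (X i x) ^ 4 + (X j x) ^ 4 + (X k x) ^ 4 + (X l x) ^ 4)"
    using fourth_moment_integrable by auto
  have "\<bar>a * b * (c * d)\<bar> \<le> a ^ 4 + b ^ 4 + c ^ 4 + d ^ 4" for a b c d :: real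
  proof -
    have h: "\<bar>x * y\<bar> \<le> x\<^sup>2 + y\<^sup>2" for x y :: real
    proof -
      have "2 * \<bar>x * y\<bar> \<le> x\<^sup>2 + y\<^sup>2"
        using sum_squares_bound[of "\<bar>x\<bar>" "\<bar>y\<bar>"] by (simp add: abs_mult)
      then show ?thesis using abs_ge_zero[of "x * y"] by linarith
    qed
    have h2: "(x * y)\<^sup>2 \<le> x ^ 4 + y ^ 4" for x y :: real
      using h[of "x\<^sup>2" "y\<^sup>2"] by (simp add: power_mult_distrib)
    show ?thesis using h[of "a * b" "c * d"] h2[of a b] h2[of c d] by linarith
  qed
  then show "AE x in M. norm (X i x * X j x * (X k x * X l x)) \<le>
      norm ((X i x) ^ 4 + (X j x) ^ 4 + (X k x) ^ 4 + (X l x) ^ 4)"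
    by (intro AE_I2) (simp add: order_trans[OF _ abs_ge_self])
qed auto

section \<open>Mixed fourth moments\<close>

lemma moment31: "(\<integral>x. (X n x) ^ 3 * X (n + int k) x \<partial>M) = \<rho> ^ k * (\<integral>x. (X n x) ^ 4 \<partial>M)"
  using linear_past_test[of "\<lambda>x. (X n x) ^ 3" n k] prod4_integrable[of n n n "n + int k"]
  by (simp add: eval_nat_numeral mult_ac)

lemma moment22: "(\<integral>x. (X n x)\<^sup>2 * (X (n + int k) x)\<^sup>2 \<partial>M) =
    \<rho> ^ (2 * k) * (\<integral>x. (X n x) ^ 4 \<partial>M) + (1 - \<rho> ^ (2 * k))"
  using quadratic_past_test[of "\<lambda>x. (X n x)\<^sup>2" n k] prod4_integrable[of n n "n + int k" "n + int k"]
    fourth_moment_integrable[of n] sq_integrable[of n] sq_integral[of n]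
  by (simp add: power2_eq_square power4_eq_xxxx mult.assoc)

text \<open>The mixed moment of two neighbouring squares can be computed by conditioning on either
  of them; comparing the two values yields stationarity of the fourth moment.\<close>

lemma fourth_moment_Suc: "(\<integral>x. (X (n + 1) x) ^ 4 \<partial>M) = (\<integral>x. (X n x) ^ 4 \<partial>M)"
proof -
  interpret R: nondegenerate_regressions M "\<lambda>n. X (- n)" \<rho> A B C D
    by (rule nondegenerate_reflected)
  have "\<rho>\<^sup>2 * (\<integral>x. (X (n + 1) x) ^ 4 \<partial>M) = \<rho>\<^sup>2 * (\<integral>x. (X n x) ^ 4 \<partial>M)"
    using moment22[of n 1] R.moment22[of "- (n + 1)" 1] by (auto simp: mult.commute add.commute)
  then show ?thesis using rho by simp
qed

text \<open>Two evaluations of the expectation of \<open>X 0 * X 2 * (X 1)\<^sup>2\<close> are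
  equated. One predicts \<open>X 2\<close> forwards and \<open>X 0\<close> backwards from time 1;
  the other replaces the square at time 1 by its two-sided regression.\<close>

lemma fourth_moment_eq:
  defines "m \<equiv> (\<integral>x. (X 0 x) ^ 4 \<partial>M)"
  shows "C * (m - 1) * \<rho>\<^sup>2 = B * (1 - \<rho> ^ 4)"
proof -
  interpret R: nondegenerate_regressions M "\<lambda>n. X (- n)" \<rho> A B C D
    by (rule nondegenerate_reflected)
  have m: "(\<integral>x. (X 1 x) ^ 4 \<partial>M) = m" "(\<integral>x. (X 2 x) ^ 4 \<partial>M) = m"
    using fourth_moment_Suc[of 0] fourth_moment_Suc[of 1] by (simp_all add: m_def)
  let ?F = "gen_alg M X {k. k \<noteq> 1}"
  have [measurable]: "X 0 \<in> borel_measurable ?F" "X 2 \<in> borel_measurable ?F"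
    by (rule measurable_gen_alg; simp)+
  have [measurable]: "X 0 \<in> borel_measurable (past 1)"
    by (rule measurable_gen_alg) simp
  have "(\<integral>x. (X 0 x * X 2 x) * (X 1 x)\<^sup>2 \<partial>M) = (\<integral>x. (X 0 x * (X 1 x)\<^sup>2) * X (1 + int 1) x \<partial>M)"
    by (simp add: mult_ac)
  also have "\<dots> = \<rho> ^ 1 * (\<integral>x. (X 0 x * (X 1 x)\<^sup>2) * X 1 x \<partial>M)"
    by (rule linear_past_test)
      (use prod4_integrable[of 0 1 1 2] in \<open>auto simp: power2_eq_square mult_ac\<close>)
  also have "\<dots> = \<rho> * (\<integral>x. (X 1 x) ^ 3 * X 0 x \<partial>M)"
    by (simp add: power2_eq_square power3_eq_cube mult_ac)
  also have "(\<integral>x. (X 1 x) ^ 3 * X 0 x \<partial>M) = \<rho> * m"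
    using R.moment31[of "- 1" 1] m by simp
  finally have 1: "(\<integral>x. (X 0 x * X 2 x) * (X 1 x)\<^sup>2 \<partial>M) = \<rho>\<^sup>2 * m"
    by (simp add: power2_eq_square)
  have i: "integrable M (\<lambda>x. (X 0 x) ^ 3 * X 2 x)" "integrable M (\<lambda>x. (X 2 x) ^ 3 * X 0 x)"
    "integrable M (\<lambda>x. (X 0 x)\<^sup>2 * (X 2 x)\<^sup>2)"
    using prod4_integrable[of 0 0 0 2] prod4_integrable[of 2 2 2 0] prod4_integrable[of 0 0 2 2]
    by (simp_all add: power2_eq_square power3_eq_cube mult_ac)
  have m31: "(\<integral>x. (X 0 x) ^ 3 * X 2 x \<partial>M) = \<rho>\<^sup>2 * m" "(\<integral>x. (X 2 x) ^ 3 * X 0 x \<partial>M) = \<rho>\<^sup>2 * m"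
    using moment31[of 0 2] R.moment31[of "- 2" 2] m by (simp_all add: m_def)
  have m22: "(\<integral>x. (X 0 x)\<^sup>2 * (X 2 x)\<^sup>2 \<partial>M) = \<rho> ^ 4 * m + (1 - \<rho> ^ 4)"
    using moment22[of 0 2] by (simp add: m_def)
  have m11: "(\<integral>x. X 0 x * X 2 x \<partial>M) = \<rho>\<^sup>2"
    using linear_past_test[of "X 0" 0 2] prod_integrable[of 0 2] sq_integral[of 0]
    by (simp add: power2_eq_square)
  have "(\<integral>x. (X 0 x * X 2 x) * (X 1 x)\<^sup>2 \<partial>M) = (\<integral>x. (X 0 x * X 2 x) *
      (A * ((X (1 - 1) x)\<^sup>2 + (X (1 + 1) x)\<^sup>2) + B * X (1 - 1) x * X (1 + 1) x
        + D * (X (1 - 1) x + X (1 + 1) x) + C) \<partial>M)"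
    by (rule quadratic_test)
      (use prod4_integrable[of 0 2 1 1] in \<open>auto simp: power2_eq_square\<close>)
  also have "\<dots> = (\<integral>x. A * ((X 0 x) ^ 3 * X 2 x + (X 2 x) ^ 3 * X 0 x)
      + B * ((X 0 x)\<^sup>2 * (X 2 x)\<^sup>2) + C * (X 0 x * X 2 x) \<partial>M)"
    by (rule Bochner_Integration.integral_cong[OF refl])
      (simp add: D_eq_0 algebra_simps power2_eq_square power3_eq_cube)
  also have "\<dots> = A * (2 * \<rho>\<^sup>2 * m) + B * (\<rho> ^ 4 * m + (1 - \<rho> ^ 4)) + C * \<rho>\<^sup>2"
    using i prod_integrable[of 0 2] m31 m22 m11 by simp
  finally have "\<rho>\<^sup>2 * m = A * (2 * \<rho>\<^sup>2 * m) + B * (\<rho> ^ 4 * m + (1 - \<rho> ^ 4)) + C * \<rho>\<^sup>2"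
    unfolding 1 .
  moreover have "C * (m - 1) * \<rho>\<^sup>2 = (1 - 2 * A - B * \<rho>\<^sup>2) * m * \<rho>\<^sup>2 - C * \<rho>\<^sup>2"
    unfolding C_eq[symmetric] by (simp add: algebra_simps)
  ultimately show ?thesis
    by (simp add: algebra_simps power2_eq_square power4_eq_xxxx)
qed

lemma al_salam_chihara_norm:
  fixes q :: real
  defines "m \<equiv> (\<integral>x. (X 0 x) ^ 4 \<partial>M)"
  shows "0 \<le> (1 - \<rho>\<^sup>2) * ((1 - \<rho>\<^sup>2 - 2 * \<rho>\<^sup>2 * q) * m + \<rho>\<^sup>2 * (2 + 4 * q + q\<^sup>2) - 1)"
proof -
  interpret R: nondegenerate_regressions M "\<lambda>n. X (- n)" \<rho> A B C D
    by (rule nondegenerate_reflected)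
  define a b c where "a = \<rho> * (1 + q)" and "b = \<rho>\<^sup>2 * q" and "c = 1 - \<rho>\<^sup>2"
  have m: "(\<integral>x. (X 1 x) ^ 4 \<partial>M) = m"
    using fourth_moment_Suc[of 0] by (simp add: m_def)
  have i: "integrable M (\<lambda>x. (X 0 x) ^ 3 * X 1 x)" "integrable M (\<lambda>x. (X 1 x) ^ 3 * X 0 x)"
    "integrable M (\<lambda>x. (X 0 x)\<^sup>2 * (X 1 x)\<^sup>2)"
    using prod4_integrable[of 0 0 0 1] prod4_integrable[of 1 1 1 0] prod4_integrable[of 0 0 1 1]
    by (simp_all add: power2_eq_square power3_eq_cube mult_ac)
  have m31: "(\<integral>x. (X 0 x) ^ 3 * X 1 x \<partial>M) = \<rho> * m" "(\<integral>x. (X 1 x) ^ 3 * X 0 x \<partial>M) = \<rho> * m"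
    using moment31[of 0 1] R.moment31[of "- 1" 1] m by (simp_all add: m_def)
  have m22: "(\<integral>x. (X 0 x)\<^sup>2 * (X 1 x)\<^sup>2 \<partial>M) = \<rho>\<^sup>2 * m + c"
    using moment22[of 0 1] by (simp add: m_def c_def)
  have m11: "(\<integral>x. X 0 x * X 1 x \<partial>M) = \<rho>"
    using linear_past_test[of "X 0" 0 1] prod_integrable[of 0 1] sq_integral[of 0]
    by (simp add: power2_eq_square)
  have "0 \<le> (\<integral>x. ((X 1 x)\<^sup>2 - a * (X 0 x * X 1 x) + b * (X 0 x)\<^sup>2 - c)\<^sup>2 \<partial>M)"
    by simp
  also have "\<dots> = (\<integral>x. (X 1 x) ^ 4 + (a\<^sup>2 + 2 * b) * ((X 0 x)\<^sup>2 * (X 1 x)\<^sup>2) + b\<^sup>2 * (X 0 x) ^ 4 + c\<^sup>2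
      - 2 * a * ((X 1 x) ^ 3 * X 0 x) - 2 * a * b * ((X 0 x) ^ 3 * X 1 x)
      - 2 * c * (X 1 x)\<^sup>2 - 2 * b * c * (X 0 x)\<^sup>2 + 2 * a * c * (X 0 x * X 1 x) \<partial>M)"
    by (rule Bochner_Integration.integral_cong[OF refl])
      (simp add: algebra_simps power2_eq_square power3_eq_cube power4_eq_xxxx)
  also have "\<dots> = m + (a\<^sup>2 + 2 * b) * (\<rho>\<^sup>2 * m + c) + b\<^sup>2 * m + c\<^sup>2
      - 2 * a * (\<rho> * m) - 2 * a * b * (\<rho> * m) - 2 * c - 2 * b * c + 2 * a * c * \<rho>"
    using i prod_integrable[of 0 1] m31 m22 m11 m fourth_moment_integrable[of 0]
      fourth_moment_integrable[of 1] sq_integrable[of 0] sq_integrable[of 1]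
      sq_integral[of 0] sq_integral[of 1] m_def
    by (simp add: prob_space)
  also have "\<dots> = (1 - \<rho>\<^sup>2) * ((1 - \<rho>\<^sup>2 - 2 * \<rho>\<^sup>2 * q) * m + \<rho>\<^sup>2 * (2 + 4 * q + q\<^sup>2) - 1)"
    unfolding a_def b_def c_def by (simp add: algebra_simps power2_eq_square)
  finally show ?thesis .
qed

end

section \<open>The parameter q and its upper bound\<close>

text \<open>Numerator and denominator of q share the factor 1 + r, where r is the square of \<rho>.
  The reduced denominator \<open>d\<close> also governs \<open>C\<close>, through
  \<open>C * (1 + r\<^sup>2) = (1 - r) * d\<close>, so both claims become polynomial identities in
  r, B and d.\<close>

lemma tsp_q_relations:
  fixes \<rho> A B q :: real
  assumes \<rho>: "0 < \<rho>" "\<rho> < 1" and q: "q > 1" "q = tsp_q \<rho> B"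
    and rel: "\<rho>\<^sup>2 - A * (1 + \<rho> ^ 4) - B * \<rho>\<^sup>2 = 0"
  defines "C \<equiv> 1 - 2 * A - B * \<rho>\<^sup>2"
  shows "C \<noteq> 0"
    and "C * (m - 1) * \<rho>\<^sup>2 = B * (1 - \<rho> ^ 4) \<Longrightarrow> m = 2 + q"
proof -
  define r where "r = \<rho>\<^sup>2"
  have r: "0 < r" "r < 1" "\<rho> ^ 4 = r\<^sup>2" using \<rho> by (auto simp: r_def power_less_one_iff)
  define d where "d = (1 - r) + r * B * (1 + r)"
  have Bt: "B * (\<rho> + 1 / \<rho>)\<^sup>2 = B * (1 + r)\<^sup>2 / r"
    using \<rho> by (simp add: r_def field_simps power2_eq_square)
  have den: "1 + \<rho> ^ 4 * (B * (\<rho> + 1 / \<rho>)\<^sup>2 - 1) = (1 + r) * d"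
    unfolding Bt r d_def using r(1) by (simp add: field_simps power2_eq_square)
  have num: "\<rho> ^ 4 + B * (\<rho> + 1 / \<rho>)\<^sup>2 - 1 = (1 + r) * (B * (1 + r) - r * (1 - r)) / r"
    unfolding Bt r using r(1) by (simp add: field_simps power2_eq_square)
  have qd: "q = (1 + r) * (B * (1 + r) - r * (1 - r)) / r / ((1 + r) * d)"
    using q(2) unfolding tsp_q_def den num .
  \<comment> \<open>Division by zero gives 0, so a vanishing denominator would mean q = 0, against q
    > 1.\<close>
  have d: "d \<noteq> 0"
  proof
    assume "d = 0"
    then have "(1 + r) * d = 0" by simp
    then have "q = 0" using qd by (simp only: div_by_0)
    then show False using q(1) by simp
  qed
  define w where "w = B * (1 + r) - r * (1 - r)"
  have "q = (1 + r) * (w / r) / ((1 + r) * d)"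
    using qd unfolding w_def times_divide_eq_right .
  also have "\<dots> = w / r / d"
    using r(1) by (intro mult_divide_mult_cancel_left) simp
  finally have qd: "q * r * d = B * (1 + r) - r * (1 - r)"
    using r(1) d by (simp add: w_def)
  have C: "C * (1 + r\<^sup>2) = (1 - r) * d"
    using rel unfolding C_def d_def r r_def[symmetric]
    by (simp add: algebra_simps power2_eq_square)
  then show "C \<noteq> 0" using d r by auto
  assume "C * (m - 1) * \<rho>\<^sup>2 = B * (1 - \<rho> ^ 4)"
  then have "C * (m - 1) * r * (1 + r\<^sup>2) = B * (1 - r\<^sup>2) * (1 + r\<^sup>2)"
    unfolding r r_def[symmetric] by simp
  moreover have "C * (m - 1) * r * (1 + r\<^sup>2) = (1 - r) * ((m - 1) * r * d)"
    using C by (simp add: mult_ac)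
  moreover have "B * (1 - r\<^sup>2) * (1 + r\<^sup>2) = (1 - r) * (B * (1 + r) * (1 + r\<^sup>2))"
    by (simp add: algebra_simps power2_eq_square)
  ultimately have "(m - 1) * r * d = B * (1 + r) * (1 + r\<^sup>2)"
    using r by simp
  also have "\<dots> = (1 + q) * r * d"
  proof -
    have "(1 + q) * r * d = r * d + (B * (1 + r) - r * (1 - r))"
      unfolding qd[symmetric] by (simp add: algebra_simps)
    then show ?thesis by (simp add: d_def algebra_simps power2_eq_square)
  qed
  finally show "m = 2 + q" using r d by simp
qed

lemma (in two_sided_regressions) rho_sq_q_le_1:
  assumes q: "q > 1" "q = tsp_q \<rho> B"
  shows "\<rho>\<^sup>2 * q \<le> 1"
proof -
  have r: "\<rho>\<^sup>2 < 1" "\<rho> ^ 4 < 1" using rho by (auto simp: power_less_one_iff)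
  have rel: "\<rho>\<^sup>2 - A * (1 + \<rho> ^ 4) - B * \<rho>\<^sup>2 = 0"
  proof (rule ccontr)
    assume "\<rho>\<^sup>2 - A * (1 + \<rho> ^ 4) - B * \<rho>\<^sup>2 \<noteq> 0"
    then have "q = (\<rho> ^ 4 - 1) / (1 - \<rho> ^ 4)"
      using degenerate_B_eq_0 q(2) by (simp add: tsp_q_def)
    then have "q \<le> 0" using r by (simp add: divide_le_0_iff)
    then show False using q(1) by simp
  qed
  interpret nondegenerate_regressions M X \<rho> A B C D
    using tsp_q_relations(1)[OF rho q rel] C_eq by unfold_locales auto
  define m where "m = (\<integral>x. (X 0 x) ^ 4 \<partial>M)"
  have "C * (m - 1) * \<rho>\<^sup>2 = B * (1 - \<rho> ^ 4)"
    unfolding m_def by (rule fourth_moment_eq)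
  \<comment> \<open>With this value the second factor of the mean square becomes
    \<open>(1 + q) * (1 - \<rho>\<^sup>2 * q)\<close>, whose sign decides the claim.\<close>
  then have m: "m = 2 + q"
    using tsp_q_relations(2)[OF rho q rel, of m] unfolding C_eq[symmetric] by blast
  have "0 \<le> (1 - \<rho>\<^sup>2) * ((1 - \<rho>\<^sup>2 - 2 * \<rho>\<^sup>2 * q) * m + \<rho>\<^sup>2 * (2 + 4 * q + q\<^sup>2) - 1)"
    unfolding m_def by (rule al_salam_chihara_norm)
  also have "\<dots> = (1 - \<rho>\<^sup>2) * ((1 + q) * (1 - \<rho>\<^sup>2 * q))"
    unfolding m by (simp add: algebra_simps power2_eq_square)
  finally show ?thesis using r q(1) by (simp add: zero_le_mult_iff)
qed

section \<open>The contradiction from a single fine mesh\<close>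

lemma correlation_eq_integral:
  assumes "one_tsp M X \<rho> q"
  shows "correlation M (X 0) (X 1) = (\<integral>x. X 0 x * X 1 x \<partial>M)"
  using assms unfolding one_tsp_def one_tsp_with_def correlation_def covariance_def
  by (auto simp: power2_eq_square)

theorem mainTheorem5:
  fixes \<alpha> q :: real
  assumes "q > 1" and "\<alpha> > 0"
  shows "\<not> (\<exists>(M :: 'a measure) (Y :: real \<Rightarrow> 'a \<Rightarrow> real). ou_process M Y \<alpha> q)"
proof
  assume "\<exists>(M :: 'a measure) (Y :: real \<Rightarrow> 'a \<Rightarrow> real). ou_process M Y \<alpha> q"
  then obtain M :: "'a measure" and Y :: "real \<Rightarrow> 'a \<Rightarrow> real" where ou: "ou_process M Y \<alpha> q"
    by blast
  \<comment> \<open>This mesh makes \<open>\<rho>\<^sup>2\<close> equal to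
    \<open>1 / sqrt q\<close>, so that \<open>\<rho>\<^sup>2 * q\<close> is \<open>sqrt q\<close>,
    which exceeds 1.\<close>
  define \<delta> where "\<delta> = ln q / (4 * \<alpha>)"
  have \<delta>: "\<delta> > 0" using assms by (simp add: \<delta>_def)
  define \<rho> where "\<rho> = exp (- \<alpha> * \<delta>)"
  have rho: "0 < \<rho>" "\<rho> < 1" using assms \<delta> by (auto simp: \<rho>_def)
  define X where "X n = Y (of_int n * \<delta>)" for n
  \<comment> \<open>The doubled mesh serves only to supply the lag-2 correlation of
    \<open>X\<close>, which is its own lag-1 correlation.\<close>
  have tsp: "one_tsp M X \<rho> q" and tsp2: "one_tsp M (\<lambda>n. Y (of_int n * (2 * \<delta>))) (exp (- \<alpha> * (2 * \<delta>))) q"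
    using ou \<delta> unfolding ou_process_def X_def \<rho>_def by auto
  have "\<rho> = correlation M (X 0) (X 1)" using tsp unfolding one_tsp_def by blast
  then have cor1: "(\<integral>x. X 0 x * X 1 x \<partial>M) = \<rho>"
    using correlation_eq_integral[OF tsp] by simp
  have "exp (- \<alpha> * (2 * \<delta>)) = (\<integral>x. Y (of_int 0 * (2 * \<delta>)) x * Y (of_int 1 * (2 * \<delta>)) x \<partial>M)"
    using correlation_eq_integral[OF tsp2] tsp2 unfolding one_tsp_def by auto
  then have cor2: "(\<integral>x. X 0 x * X 2 x \<partial>M) = \<rho>\<^sup>2"
    by (simp add: X_def \<rho>_def exp_double[symmetric] mult_ac)
  obtain a A B C D where ext: "one_tsp_with M X a A B C D" and qB: "q = tsp_q \<rho> B"
    using tsp unfolding one_tsp_def by blast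
  interpret prob_space M using ext unfolding one_tsp_with_def by simp
  have X [measurable]: "\<And>n. X n \<in> borel_measurable M"
    and sq: "\<And>n. integrable M (\<lambda>x. (X n x)\<^sup>2)" "\<And>n. (\<integral>x. (X n x)\<^sup>2 \<partial>M) = 1"
    and lin: "\<And>n. AE x in M. real_cond_exp M (gen_alg M X {k. k \<noteq> n}) (X n) x =
      a * (X (n - 1) x + X (n + 1) x)"
    and quad: "\<And>n. AE x in M. real_cond_exp M (gen_alg M X {k. k \<noteq> n}) (\<lambda>x. (X n x)\<^sup>2) x =
        A * ((X (n - 1) x)\<^sup>2 + (X (n + 1) x)\<^sup>2) + B * X (n - 1) x * X (n + 1) x
        + D * (X (n - 1) x + X (n + 1) x) + C"
    using ext unfolding one_tsp_with_def sigma_except_eq_gen_alg by auto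
  have i: "integrable M (\<lambda>x. X j x * X k x)" for j k
    by (rule square_integrable_prod[OF X X sq(1) sq(1)])
  \<comment> \<open>Testing the linear regression at time 1 with \<open>X 0\<close> gives \<rho> =
    \<open>a * (1 + \<rho>\<^sup>2)\<close>, which determines \<open>a\<close>.\<close>
  have "(\<integral>x. X 0 x * X 1 x \<partial>M) = (\<integral>x. X 0 x * (a * (X (1 - 1) x + X (1 + 1) x)) \<partial>M)"
    by (rule real_cond_exp_test[OF subalgebra_gen_alg lin[of 1]])
      (auto intro: measurable_gen_alg i)
  also have "\<dots> = (\<integral>x. a * ((X 0 x)\<^sup>2 + X 0 x * X 2 x) \<partial>M)"
    by (rule Bochner_Integration.integral_cong[OF refl]) (simp add: algebra_simps power2_eq_square)
  also have "\<dots> = a * (1 + \<rho>\<^sup>2)"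
    using sq i[of 0 2] cor2 by simp
  finally have a: "a = \<rho> / (1 + \<rho>\<^sup>2)"
    unfolding cor1 by (simp add: field_simps add_nonneg_eq_0_iff)
  interpret two_sided_regressions M X \<rho> A B C D
    using X sq rho lin quad unfolding a by unfold_locales auto
  have "\<rho>\<^sup>2 * q = exp (- (2 * \<alpha> * \<delta>)) * exp (ln q)"
    using assms by (simp add: \<rho>_def exp_double[symmetric] mult_ac)
  also have "\<dots> = exp (ln q / 2)"
    unfolding exp_add[symmetric] using assms by (simp add: \<delta>_def field_simps)
  also have "\<dots> > 1" using assms by simp
  finally show False using rho_sq_q_le_1[OF assms(1) qB] by simp
qed

end
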